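(* Let $\lambda$ be a nonzero real number, $k\in\mathbb{Z}$, and let $Y$ be the Bernoulli random variable with probability of success $p$. For every positive integer $n$, $$\mathrm{Bel}_{n,\lambda}^{(k,Y)}(x)=\sum_{j=1}^{n}\sum_{l=1}^{j}\sum_{m=1}^{l}\frac{(1)_{m,\lambda}}{m^{k-1}}S_{1,\lambda}(l,m){j \brace l}_{\lambda}{n \brace j}_{\lambda}p^{j}x^{j}.$$
   Context: Degenerate falling factorial: $(x)_{0,\lambda}=1$, $(x)_{n,\lambda}=x(x-\lambda)\cdots(x-(n-1)\lambda)$ for $n\ge1$. Degenerate exponential: $e_\lambda^x(t)=(1+\lambda t)^{x/\lambda}=\sum_{n\ge0}(x)_{n,\lambda}\frac{t^n}{n!}$, $e_\lambda(t)=e_\lambda^1(t)$. For $k\in\mathbb{Z}$, $\mathrm{Ei}_{k,\lambda}(x)=\sum_{n=1}^{\infty}\frac{(1)_{n,\lambda}}{(n-1)!\,n^{k}}x^{n}$. The probabilistic degenerate poly-Bell polynomials $\mathrm{Bel}_{n,\lambda}^{(k,Y)}(x)$ are defined by $\mathrm{Ei}_{k,\lambda}\big(x(E[e_\lambda^Y(t)]-1)\big)=\sum_{n=1}^{\infty}\mathrm{Bel}_{n,\lambda}^{(k,Y)}(x)\frac{t^n}{n!}$ (power series in $t$), with $\mathrm{Bel}_{0,\lambda}^{(k,Y)}(x)=1$. The degenerate Stirling numbers of the second kind are defined by $\frac{1}{k!}(e_\lambda(t)-1)^k=\sum_{n\ge k}{n \brace k}_{\lambda}\frac{t^n}{n!}$.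 The degenerate logarithm is $\log_\lambda(1+t)=\frac{1}{\lambda}((1+t)^\lambda-1)$, and the degenerate Stirling numbers of the first kind are defined by $\frac{1}{k!}(\log_\lambda(1+t))^k=\sum_{n\ge k}S_{1,\lambda}(n,k)\frac{t^n}{n!}$. *)

theory Defs
  imports "HOL-Probability.Probability" "HOL-Computational_Algebra.Formal_Power_Series"
begin

definition deg_ffact :: "real \<Rightarrow> real \<Rightarrow> nat \<Rightarrow> real" where
  "deg_ffact lam x n = (\<Prod>i<n. x - real i * lam)"

text \<open>The formal power series \<open>(1 + lam t) ^ (x / lam)\<close> in \<open>t\<close>, for \<open>lam \<noteq> 0\<close>.\<close>
definition deg_exp :: "real \<Rightarrow> real \<Rightarrow> real fps" where
  "deg_exp lam x = fps_compose (fps_binomial (x / lam)) (fps_const lam * fps_X)"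

lemma deg_exp_nth:
  assumes "lam \<noteq> 0"
  shows "fps_nth (deg_exp lam x) n = deg_ffact lam x n / fact n"
proof -
  have "(\<Prod>i<n. x - real i * lam) = (\<Prod>i<n. lam * (x / lam - real i))"
    using assms by (intro prod.cong) (auto simp: field_simps)
  also have "\<dots> = lam ^ n * (\<Prod>i<n. x / lam - real i)"
    by (simp add: prod.distrib)
  finally show ?thesis
    by (simp add: deg_exp_def deg_ffact_def gbinomial_prod_rev atLeast0LessThan)
qed

text \<open>The formal power series \<open>((1 + t) ^ lam - 1) / lam\<close> in \<open>t\<close>, for \<open>lam \<noteq> 0\<close>.\<close>
definition deg_log :: "real \<Rightarrow> real fps" where
  "deg_log lam = fps_const (1 / lam) * (fps_binomial lam - 1)"

definition deg_Ei :: "int \<Rightarrow> real \<Rightarrow> real fps" where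
  "deg_Ei k lam = Abs_fps (\<lambda>n. if n = 0 then 0
     else deg_ffact lam 1 n / (fact (n - 1) * real n powi k))"

definition deg_Stirling1 :: "real \<Rightarrow> nat \<Rightarrow> nat \<Rightarrow> real" where
  "deg_Stirling1 lam n k = fact n * fps_nth (fps_const (1 / fact k) * deg_log lam ^ k) n"

definition deg_Stirling2 :: "real \<Rightarrow> nat \<Rightarrow> nat \<Rightarrow> real" where
  "deg_Stirling2 lam n k = fact n * fps_nth (fps_const (1 / fact k) * (deg_exp lam 1 - 1) ^ k) n"

text \<open>\<open>E[e_lam^Y(t)]\<close> as a power series in \<open>t\<close>: the expectation is taken coefficientwise,
  so that the \<open>n\<close>-th coefficient is the expectation of \<open>deg_ffact lam Y n / n!\<close>.\<close>
definition expect_deg_exp :: "'a measure \<Rightarrow> ('a \<Rightarrow> real) \<Rightarrow> real \<Rightarrow> real fps" where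
  "expect_deg_exp M Y lam = Abs_fps (\<lambda>n. \<integral>\<omega>. fps_nth (deg_exp lam (Y \<omega>)) n \<partial>M)"

definition prob_deg_poly_Bell ::
    "'a measure \<Rightarrow> ('a \<Rightarrow> real) \<Rightarrow> int \<Rightarrow> real \<Rightarrow> nat \<Rightarrow> real \<Rightarrow> real" where
  "prob_deg_poly_Bell M Y k lam n x = (if n = 0 then 1
     else fact n * fps_nth (fps_compose (deg_Ei k lam)
                              (fps_const x * (expect_deg_exp M Y lam - 1))) n)"

definition bernoulli_rv :: "'a measure \<Rightarrow> ('a \<Rightarrow> real) \<Rightarrow> real \<Rightarrow> bool" where
  "bernoulli_rv M Y p \<longleftrightarrow> prob_space M \<and> Y \<in> borel_measurable M \<and>
     measure M {\<omega> \<in> space M. Y \<omega> = 1} = p \<and> measure M {\<omega> \<in> space M. Y \<omega> = 0} = 1 - p"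

end

theory Submission imports Defs begin

text \<open>
  For a Bernoulli variable, \<open>E[e_lam^Y(t)] - 1 = p (e_lam(t) - 1)\<close>, so comparing coefficients in
  \<open>Ei_k(x p (e_lam(t) - 1))\<close> gives the single sum over \<open>j\<close> of
  \<open>(1)_{j,lam} / j^(k-1) {n brace j}_lam (p x)^j\<close>.
  The triple sum collapses to this one, because \<open>log_lam\<close> is compositionally inverse to
  \<open>e_lam - 1\<close> and hence the two kinds of degenerate Stirling numbers are mutually inverse matrices.
\<close>

text \<open>This is the power law \<open>((1 + X)^a)^c = (1 + X)^(c * a)\<close>. The composite has
  constant term 1 and satisfies the differential equation \<open>(1 + X) f' = c a f\<close>, which
  determines the binomial series.\<close>

lemma fps_binomial_compose_fps_binomial:
  fixes a c :: "'a :: field_char_0"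
  shows "fps_binomial c oo (fps_binomial a - 1) = fps_binomial (c * a)"
proof -
  let ?B = "fps_binomial a" and ?F = "fps_binomial c"
  have B0: "fps_nth (?B - 1) 0 = 0" by simp
  have div_iff: "f = g / (1 + fps_X) \<longleftrightarrow> f * (1 + fps_X) = g" for f g :: "'a fps"
  proof -
    have "inverse (1 + fps_X) * (1 + fps_X) = (1 :: 'a fps)"
      by (rule inverse_mult_eq_1) simp
    then show ?thesis
      by (auto simp: fps_divide_unit mult.assoc mult.commute[of "1 + fps_X"])
  qed
  have ode: "fps_deriv (fps_binomial d) * (1 + fps_X) = fps_const d * fps_binomial d" for d :: 'a
    using fps_binomial_deriv[of d] by (simp only: div_iff)
  have "fps_deriv (?F oo (?B - 1)) * (1 + fps_X)
      = (fps_deriv ?F oo (?B - 1)) * (fps_const a * ?B)"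
    using B0 by (simp add: fps_compose_deriv mult.assoc ode)
  \<comment> \<open>Since \<open>?B\<close> is \<open>1 + fps_X\<close> composed with
    \<open>?B - 1\<close>, it can be absorbed into the composition, where the equation for
    \<open>?F\<close> applies.\<close>
  also have "\<dots> = fps_const a * ((fps_deriv ?F * (1 + fps_X)) oo (?B - 1))"
    using B0 by (simp add: fps_compose_mult_distrib fps_compose_add_distrib)
  also have "\<dots> = fps_const (c * a) * (?F oo (?B - 1))"
    using B0 by (simp add: ode fps_compose_mult_distrib flip: fps_const_mult)
  finally show ?thesis
    by (intro iffD1[OF fps_binomial_ODE_unique']) (simp add: div_iff)
qed

lemma deg_exp_nth_0 [simp]: "fps_nth (deg_exp lam x) 0 = 1"
  by (simp add: deg_exp_def)

lemma deg_log_compose_deg_exp: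
  assumes "lam \<noteq> 0"
  shows "deg_log lam oo (deg_exp lam 1 - 1) = fps_X"
proof -
  let ?L = "fps_const lam * fps_X :: real fps" and ?B = "fps_binomial (1 / lam) :: real fps"
  \<comment> \<open>By associativity the rescaling \<open>?L\<close> moves outside, so that the
    exponents \<open>lam\<close> and \<open>1 / lam\<close> cancel by the power law.\<close>
  have "fps_binomial lam oo (deg_exp lam 1 - 1) = fps_binomial lam oo ((?B - 1) oo ?L)"
    by (simp add: deg_exp_def fps_compose_sub_distrib)
  also have "\<dots> = (fps_binomial lam oo (?B - 1)) oo ?L"
    by (simp add: fps_compose_assoc)
  also have "\<dots> = 1 + ?L"
    using assms by (simp add: fps_binomial_compose_fps_binomial fps_binomial_1
        fps_compose_add_distrib)
  finally have "fps_binomial lam oo (deg_exp lam 1 - 1) = 1 + ?L" .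
  then show ?thesis
    using assms by (simp add: deg_log_def fps_compose_mult_distrib fps_compose_sub_distrib
        flip: mult.assoc)
qed

lemma deg_Stirling1_eq_0: "l < m \<Longrightarrow> deg_Stirling1 lam l m = 0"
  by (simp add: deg_Stirling1_def deg_log_def startsby_zero_power_prefix)

text \<open>Up to the factor \<open>j!\<close>, the sum is the \<open>j\<close>-th coefficient of
  \<open>deg_log lam ^ m / m!\<close> composed with \<open>deg_exp lam 1 - 1\<close>, which is
  \<open>X^m / m!\<close>.\<close>

lemma deg_Stirling_orthogonal:
  assumes "lam \<noteq> 0" "m > 0"
  shows "(\<Sum>l=1..j. deg_Stirling1 lam l m * deg_Stirling2 lam j l) = (if j = m then 1 else 0)"
proof -
  let ?u = "deg_exp lam 1 - 1" and ?g = "fps_const (1 / fact m) * deg_log lam ^ m"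
  have "(\<Sum>l=1..j. deg_Stirling1 lam l m * deg_Stirling2 lam j l)
      = (\<Sum>l=0..j. deg_Stirling1 lam l m * deg_Stirling2 lam j l)"
    using assms by (intro sum.mono_neutral_left) (auto simp: deg_Stirling1_eq_0 not_less_eq_eq)
  \<comment> \<open>The \<open>l!\<close> in \<open>deg_Stirling1\<close> cancels the
    \<open>1 / l!\<close> in \<open>deg_Stirling2\<close>.\<close>
  also have "\<dots> = fact j * fps_nth (?g oo ?u) j"
    unfolding fps_compose_nth sum_distrib_left
    by (intro sum.cong) (auto simp: deg_Stirling1_def deg_Stirling2_def)
  also have "?g oo ?u = fps_const (1 / fact m) * fps_X ^ m"
    using assms by (simp add: fps_compose_mult_distrib fps_compose_power[symmetric]
        deg_log_compose_deg_exp)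
  finally show ?thesis by simp
qed

lemma expect_deg_exp_bernoulli:
  assumes "lam \<noteq> 0" "bernoulli_rv M Y p"
  shows "expect_deg_exp M Y lam - 1 = fps_const p * (deg_exp lam 1 - 1)"
proof (rule fps_ext)
  fix n
  interpret prob_space M using assms by (simp add: bernoulli_rv_def)
  have Y [measurable]: "Y \<in> borel_measurable M"
    and p1: "prob {\<omega> \<in> space M. Y \<omega> = 1} = p"
    and p0: "prob {\<omega> \<in> space M. Y \<omega> = 0} = 1 - p"
    using assms by (auto simp: bernoulli_rv_def)
  have "prob ({\<omega> \<in> space M. Y \<omega> = 1} \<union> {\<omega> \<in> space M. Y \<omega> = 0}) = 1"
    by (subst finite_measure_Union) (auto simp: p0 p1)
  then have "prob {\<omega> \<in> space M. Y \<omega> = 1 \<or> Y \<omega> = 0} = 1"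
    by (simp add: Collect_disj_eq[symmetric] conj_disj_distribL)
  then have AE: "AE \<omega> in M. Y \<omega> = 1 \<or> Y \<omega> = 0"
    by (subst (asm) prob_Collect_eq_1) auto
  show "fps_nth (expect_deg_exp M Y lam - 1) n = fps_nth (fps_const p * (deg_exp lam 1 - 1)) n"
  proof (cases "n = 0")
    case True
    then show ?thesis by (simp add: expect_deg_exp_def prob_space)
  next
    case False
    \<comment> \<open>The outcome 0 contributes only to the constant term, so for positive
      \<open>n\<close> the integrand is almost surely supported on the success event.\<close>
    have at0: "fps_nth (deg_exp lam 0) n = 0"
      using False by (simp add: deg_exp_def)
    have "(\<integral>\<omega>. fps_nth (deg_exp lam (Y \<omega>)) n \<partial>M)
        = (\<integral>\<omega>. indicator {\<omega> \<in> space M. Y \<omega> = 1} \<omega> * fps_nth (deg_exp lam 1) n \<partial>M)"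
    proof (rule integral_cong_AE)
      show "(\<lambda>\<omega>. fps_nth (deg_exp lam (Y \<omega>)) n) \<in> borel_measurable M"
        unfolding deg_exp_nth[OF assms(1)] deg_ffact_def by measurable
      show "AE \<omega> in M. fps_nth (deg_exp lam (Y \<omega>)) n =
          indicator {\<omega> \<in> space M. Y \<omega> = 1} \<omega> * fps_nth (deg_exp lam 1) n"
        using AE AE_space by eventually_elim (auto simp: at0)
    qed measurable
    also have "\<dots> = p * fps_nth (deg_exp lam 1) n"
      by (simp add: p1)
    finally show ?thesis using False by (simp add: expect_deg_exp_def)
  qed
qed

lemma prob_deg_poly_Bell_bernoulli:
  assumes "lam \<noteq> 0" "bernoulli_rv M Y p" "n > 0"
  shows "prob_deg_poly_Bell M Y k lam n x =
    (\<Sum>j=1..n. deg_ffact lam 1 j / real j powi (k - 1) * deg_Stirling2 lam n j * p ^ j * x ^ j)"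
proof -
  let ?u = "deg_exp lam 1 - 1"
  have "prob_deg_poly_Bell M Y k lam n x
      = fact n * fps_nth (deg_Ei k lam oo (fps_const (x * p) * ?u)) n"
    using assms by (simp add: prob_deg_poly_Bell_def expect_deg_exp_bernoulli
        flip: mult.assoc)
  also have "\<dots> = (\<Sum>j=0..n. fact n * (fps_nth (deg_Ei k lam) j
      * ((x * p) ^ j * fps_nth (?u ^ j) n)))"
    by (simp add: fps_compose_nth sum_distrib_left power_mult_distrib)
  also have "\<dots> = (\<Sum>j=1..n. fact n * (fps_nth (deg_Ei k lam) j
      * ((x * p) ^ j * fps_nth (?u ^ j) n)))"
    by (intro sum.mono_neutral_right) (auto simp: deg_Ei_def not_less_eq_eq)
  also have "\<dots> = (\<Sum>j=1..n. deg_ffact lam 1 j / real j powi (k - 1)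
      * deg_Stirling2 lam n j * p ^ j * x ^ j)"
  proof (intro sum.cong refl)
    fix j assume "j \<in> {1..n}"
    then have j: "j > 0" by simp
    \<comment> \<open>One factor \<open>j\<close> is split off \<open>j^k\<close> to turn
      \<open>(j - 1)!\<close> into the \<open>j!\<close> that \<open>deg_Stirling2\<close> requires;
      this is where the exponent \<open>k - 1\<close> comes from.\<close>
    have "real j powi k = real j powi (k - 1) * real j"
      using j power_int_add_1[of "real j" "k - 1"] by simp
    moreover have "fact j = real j * fact (j - 1)"
      using j by (simp add: fact_reduce)
    ultimately show "fact n * (fps_nth (deg_Ei k lam) j * ((x * p) ^ j * fps_nth (?u ^ j) n))
        = deg_ffact lam 1 j / real j powi (k - 1) * deg_Stirling2 lam n j * p ^ j * x ^ j"
      using j by (simp add: deg_Ei_def deg_Stirling2_def field_simps)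
  qed
  finally show ?thesis .
qed

theorem theorem2p7:
  fixes lam p x :: real and k :: int and n :: nat
    and M :: "'a measure" and Y :: "'a \<Rightarrow> real"
  assumes "lam \<noteq> 0"
    and "0 \<le> p" and "p \<le> 1"
    and "bernoulli_rv M Y p"
    and "n > 0"
  shows "prob_deg_poly_Bell M Y k lam n x =
    (\<Sum>j=1..n. \<Sum>l=1..j. \<Sum>m=1..l.
       deg_ffact lam 1 m / real m powi (k - 1) * deg_Stirling1 lam l m
         * deg_Stirling2 lam j l * deg_Stirling2 lam n j * p ^ j * x ^ j)"
proof -
  define c where "c m = deg_ffact lam 1 m / real m powi (k - 1)" for m
  have collapse: "(\<Sum>l=1..j. \<Sum>m=1..l. c m * deg_Stirling1 lam l m * deg_Stirling2 lam j l) = c j"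
    if "j > 0" for j
  proof -
    \<comment> \<open>The added terms have \<open>l < m\<close>, where \<open>deg_Stirling1\<close>
      vanishes. On the resulting square the sums can be swapped, and orthogonality keeps only
      \<open>m = j\<close>.\<close>
    have "(\<Sum>l=1..j. \<Sum>m=1..l. c m * deg_Stirling1 lam l m * deg_Stirling2 lam j l)
        = (\<Sum>l=1..j. \<Sum>m=1..j. c m * deg_Stirling1 lam l m * deg_Stirling2 lam j l)"
      by (intro sum.cong refl sum.mono_neutral_left) (auto simp: deg_Stirling1_eq_0)
    also have "\<dots> = (\<Sum>m=1..j. c m *
        (\<Sum>l=1..j. deg_Stirling1 lam l m * deg_Stirling2 lam j l))"
      by (subst sum.swap) (simp add: sum_distrib_left mult.assoc)
    also have "\<dots> = (\<Sum>m=1..j. if j = m then c m else 0)"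
      using assms(1) by (intro sum.cong refl, subst deg_Stirling_orthogonal) auto
    also have "\<dots> = c j" using that by simp
    finally show ?thesis .
  qed
  have "prob_deg_poly_Bell M Y k lam n x =
      (\<Sum>j=1..n. c j * deg_Stirling2 lam n j * p ^ j * x ^ j)"
    using assms by (simp add: prob_deg_poly_Bell_bernoulli c_def)
  also have "\<dots> = (\<Sum>j=1..n. (\<Sum>l=1..j. \<Sum>m=1..l.
      c m * deg_Stirling1 lam l m * deg_Stirling2 lam j l) * deg_Stirling2 lam n j * p ^ j * x ^ j)"
    by (intro sum.cong refl, subst collapse) auto
  finally show ?thesis by (simp add: sum_distrib_right c_def)
qed

end
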